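(* Let $\mathbb T\subseteq\mathbb R^n$ be nonempty and let $\mathcal H:\mathbb T\to\mathcal F_{\mathcal C}$ be a fuzzy function that is gH-differentiable at $x^*\in\mathbb T$. If $x^*$ is a local optimal solution of the problem $\min_{x\in\mathbb T}\mathcal H(x)$, then $\hat{\mathcal H}(x^* )\cap\hat S(x^* )=\emptyset$, where $\hat{\mathcal H}(x^* )=\{\tau\in\mathbb R^n:\tau^\top\nabla\mathcal H(x^* )\prec\tilde 0\}$ and $\hat S(x^* )=\{\tau\in\mathbb R^n: \text{there is }\delta>0\text{ such that }x^*+\kappa\tau\in\mathbb T\text{ for all }\kappa\in(0,\delta)\}$.
   Context: Fuzzy numbers. A fuzzy number is a function $m:\mathbb R\to[0,1]$ that is normal ($m(x)=1$ for some $x$), upper semicontinuous, satisfies $m(\vartheta x_1+(1-\vartheta)x_2)\ge\min\{m(x_1),m(x_2)\}$ for all $x_1,x_2\in\mathbb R$, $\vartheta\in[0,1]$, and has compact $0$-cut. Its $\varrho$-cuts are $[m]^\varrho=\{x:m(x)\ge\varrho\}$ for $\varrho\in(0,1]$ and $[m]^0=\overline{\{x:m(x)>0\}}$; they are compact intervals $[m]^\varrho=[\underline m^\varrho,\overline m^\varrho]$. $\mathcal F_{\mathcal C}$ is the set of fuzzy numbers. A real $\ell$ is identified with the fuzzy number $\tilde\ell$ with $[\tilde\ell]^\varrho=[\ell,\ell]$ for all $\varrho$. Addition and real scalar multiplication are cutwise: $[m+l]^\varrho=[\underline m^\varrho+\underline l^\varrho,\overline m^\varrho+\overline l^\varrho]$,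 $[\vartheta m]^\varrho=[\min\{\vartheta\underline m^\varrho,\vartheta\overline m^\varrho\},\max\{\vartheta\underline m^\varrho,\vartheta\overline m^\varrho\}]$. Distance: $\mathfrak D(m,l)=\sup_{\varrho\in[0,1]}\max\{|\underline m^\varrho-\underline l^\varrho|,|\overline m^\varrho-\overline l^\varrho|\}$. gH-difference. $m\ominus_{gH}l$ is the fuzzy number $\gamma$, if it exists, with $m=l+\gamma$ or $l=m+(-1)\gamma$; then $[m\ominus_{gH}l]^\varrho=[\min\{\underline m^\varrho-\underline l^\varrho,\overline m^\varrho-\overline l^\varrho\},\max\{\underline m^\varrho-\underline l^\varrho,\overline m^\varrho-\overline l^\varrho\}]$. Order. $m\prec l$ means $\underline m^\varrho<\underline l^\varrho$ and $\overline m^\varrho<\overline l^\varrho$ for all $\varrho\in[0,1]$. Differentiability. For $\mathcal H:\mathbb T\subseteq\mathbb R^n\to\mathcal F_{\mathcal C}$, all limits are in $\mathfrak D$, over increments keeping the point in $\mathbb T$. The partial gH-derivative is $D_i\mathcal H(x^* )=\lim_{d\to0}\frac1d(\mathcal H(x^*+de_i)\ominus_{gH}\mathcal H(x^* ))\in\mathcal F_{\mathcal C}$ (0 being a limit point of the admissible $d$), and $\nabla\mathcal H(x^* )=(D_1\mathcal H(x^* ),\dots,D_n\mathcal H(x^* ))^\top$. For $\tau\in\mathbb R^n$, $\tau^\top\nabla\mathcal H(x^* )=\sum_i\tau_iD_i\mathcal H(x^* )$. $\mathcal H$ is gH-differentiable at $x^*$ if all $D_i\mathcal H(x^* )$ exist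 and, for every $\tau$ (for which $0$ is a limit point of the $\kappa>0$ with $x^*+\kappa\tau\in\mathbb T$), $\lim_{\kappa\to0^+}\frac1\kappa(\mathcal H(x^*+\kappa\tau)\ominus_{gH}\mathcal H(x^* ))$ exists and equals $\tau^\top\nabla\mathcal H(x^* )$. Existence of these limits includes existence of the gH-differences for all sufficiently small admissible increments. Local optimal solution: $x^*\in\mathbb T$ such that for some $\delta>0$ there is no $x\in\mathbb T$ with $0<|x-x^*|<\delta$ and $\mathcal H(x)\prec\mathcal H(x^* )$. *)

theory Defs
  imports "HOL-Analysis.Analysis"
begin

definition upper_semicontinuous :: "(real \<Rightarrow> real) \<Rightarrow> bool" where
  "upper_semicontinuous f \<longleftrightarrow> (\<forall>x. \<forall>y>f x. \<forall>\<^sub>F z in nhds x. f z < y)"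

definition fcut :: "(real \<Rightarrow> real) \<Rightarrow> real \<Rightarrow> real set" where
  "fcut m \<rho> = (if \<rho> = 0 then closure {x. 0 < m x} else {x. \<rho> \<le> m x})"

definition is_fuzzy_number :: "(real \<Rightarrow> real) \<Rightarrow> bool" where
  "is_fuzzy_number m \<longleftrightarrow>
     range m \<subseteq> {0..1} \<and>
     (\<exists>x. m x = 1) \<and>
     upper_semicontinuous m \<and>
     (\<forall>x1 x2. \<forall>\<theta>\<in>{0..1}. min (m x1) (m x2) \<le> m (\<theta> * x1 + (1 - \<theta>) * x2)) \<and>
     compact (fcut m 0)"

lemma fcut_indicator: "\<rho> \<in> {0..1} \<Longrightarrow> fcut (indicator {l}) \<rho> = {l}"
proof -
  assume r: "\<rho> \<in> {0..1}"
  have 1: "{x. 0 < (indicator {l} x :: real)} = {l}"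
    by (auto simp: indicator_def)
  show ?thesis using r unfolding fcut_def 1 by (auto simp: indicator_def split: if_splits)
qed

lemma is_fuzzy_number_indicator: "is_fuzzy_number (indicator {l})"
  unfolding is_fuzzy_number_def
proof (intro conjI allI ballI)
  show "range (indicator {l} :: real \<Rightarrow> real) \<subseteq> {0..1}" by (auto simp: indicator_def)
  show "\<exists>x. (indicator {l} x :: real) = 1" by (rule exI[of _ l]) auto
  show "upper_semicontinuous (indicator {l})"
    unfolding upper_semicontinuous_def
  proof (intro allI impI)
    fix x y :: real assume y: "indicator {l} x < y"
    show "\<forall>\<^sub>F z in nhds x. indicator {l} z < y"
    proof (cases "x = l")
      case True
      then have "1 < y" using y by simp
      then show ?thesis by (intro always_eventually) (auto simp: indicator_def)
    next
      case False
      then have "\<forall>\<^sub>F z in nhds x. z \<noteq> l" by (rule t1_space_nhds)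
      then show ?thesis by eventually_elim (use y False in \<open>auto simp: indicator_def\<close>)
    qed
  qed
  fix x1 x2 \<theta> :: real
  show "min (indicator {l} x1) (indicator {l} x2) \<le> (indicator {l} (\<theta> * x1 + (1 - \<theta>) * x2) :: real)"
    by (auto simp: indicator_def min_def algebra_simps)
next
  show "compact (fcut (indicator {l}) 0)" by (simp add: fcut_indicator)
qed

typedef fuzzy = "{m. is_fuzzy_number m}"
  morphisms membership Fuzzy
  using is_fuzzy_number_indicator by blast

definition rho_cut :: "fuzzy \<Rightarrow> real \<Rightarrow> real set" where
  "rho_cut m = fcut (membership m)"

text \<open>Cuts are nonempty compact intervals (\<open>rho_cut_eq\<close> below), so these are their endpoints.\<close>

definition lo :: "fuzzy \<Rightarrow> real \<Rightarrow> real" where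
  "lo m \<rho> = Inf (rho_cut m \<rho>)"

definition hi :: "fuzzy \<Rightarrow> real \<Rightarrow> real" where
  "hi m \<rho> = Sup (rho_cut m \<rho>)"

definition crisp :: "real \<Rightarrow> fuzzy" where
  "crisp l = Fuzzy (indicator {l})"

lemma is_fuzzy_number_membership: "is_fuzzy_number (membership m)"
  using membership by simp

lemma membership_range: "0 \<le> membership m x" "membership m x \<le> 1"
proof -
  have "membership m x \<in> {0..1}"
    using is_fuzzy_number_membership[of m] unfolding is_fuzzy_number_def by blast
  then show "0 \<le> membership m x" "membership m x \<le> 1" by auto
qed

lemma rho_cut_pos: "\<rho> \<noteq> 0 \<Longrightarrow> rho_cut m \<rho> = {x. \<rho> \<le> membership m x}"
  by (simp add: rho_cut_def fcut_def)

lemma rho_cut_zero: "rho_cut m 0 = closure {x. 0 < membership m x}"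
  by (simp add: rho_cut_def fcut_def)

lemma rho_cut_antimono: "0 \<le> \<rho> \<Longrightarrow> \<rho> \<le> \<sigma> \<Longrightarrow> rho_cut m \<sigma> \<subseteq> rho_cut m \<rho>"
proof (cases "\<rho> = 0")
  case True
  assume "0 \<le> \<rho>" "\<rho> \<le> \<sigma>"
  show ?thesis
  proof (cases "\<sigma> = 0")
    case False
    then have "{x. \<sigma> \<le> membership m x} \<subseteq> {x. 0 < membership m x}"
      using \<open>\<rho> \<le> \<sigma>\<close> True by auto
    then show ?thesis
      using closure_subset[of "{x. 0 < membership m x}"] True False
      by (auto simp: rho_cut_pos rho_cut_zero)
  qed (use True in simp)
qed (auto simp: rho_cut_pos)

lemma rho_cut_nonempty: "\<rho> \<in> {0..1} \<Longrightarrow> rho_cut m \<rho> \<noteq> {}"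
proof -
  assume r: "\<rho> \<in> {0..1}"
  obtain x where "membership m x = 1"
    using is_fuzzy_number_membership[of m] unfolding is_fuzzy_number_def by blast
  then have "x \<in> rho_cut m 1" by (simp add: rho_cut_pos)
  then show ?thesis using rho_cut_antimono[of \<rho> 1 m] r by auto
qed

lemma compact_cut: assumes "\<rho> \<in> {0..1}" shows "compact (rho_cut m \<rho>)"
proof (cases "\<rho> = 0")
  case True
  then show ?thesis using is_fuzzy_number_membership[of m]
    unfolding is_fuzzy_number_def rho_cut_def by simp
next
  case False
  have "open (- rho_cut m \<rho>)"
  proof (subst open_subopen, intro ballI)
    fix x assume "x \<in> - rho_cut m \<rho>"
    then have "membership m x < \<rho>" using False by (auto simp: rho_cut_pos)
    then have "\<forall>\<^sub>F z in nhds x. membership m z < \<rho>"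
      using is_fuzzy_number_membership[of m]
      unfolding is_fuzzy_number_def upper_semicontinuous_def by blast
    then obtain U where "open U" "x \<in> U" "\<forall>z\<in>U. membership m z < \<rho>"
      unfolding eventually_nhds by blast
    then show "\<exists>T. open T \<and> x \<in> T \<and> T \<subseteq> - rho_cut m \<rho>"
      using False by (intro exI[of _ U]) (force simp: rho_cut_pos)
  qed
  then have "closed (rho_cut m \<rho>)" by (simp add: closed_def)
  moreover have "compact (rho_cut m 0)" using is_fuzzy_number_membership[of m]
    unfolding is_fuzzy_number_def rho_cut_def by simp
  moreover have "rho_cut m \<rho> \<subseteq> rho_cut m 0" using assms by (intro rho_cut_antimono) auto
  ultimately show ?thesis by (metis compact_Int_closed inf.absorb_iff2)
qed

lemma convex_superlevel:
  "convex {x. \<rho> \<le> membership m x}" "convex {x. \<rho> < membership m x}"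
proof -
  have *: "min (membership m x) (membership m y) \<le> membership m (u * x + v * y)"
    if "0 \<le> u" "0 \<le> v" "u + v = 1" for u v x y
  proof -
    have "v = 1 - u" "u \<in> {0..1}" using that by auto
    then show ?thesis using is_fuzzy_number_membership[of m]
      unfolding is_fuzzy_number_def by blast
  qed
  show "convex {x. \<rho> \<le> membership m x}"
    unfolding convex_def by (auto intro: order_trans[OF _ *])
  show "convex {x. \<rho> < membership m x}"
    unfolding convex_def by (auto intro: less_le_trans[OF _ *])
qed

lemma convex_cut: "convex (rho_cut m \<rho>)"
  by (cases "\<rho> = 0") (auto simp: rho_cut_pos rho_cut_zero intro: convex_superlevel convex_closure)

lemma rho_cut_eq: assumes "\<rho> \<in> {0..1}" shows "rho_cut m \<rho> = {lo m \<rho>..hi m \<rho>}"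
proof -
  have c: "compact (rho_cut m \<rho>)" "rho_cut m \<rho> \<noteq> {}" "connected (rho_cut m \<rho>)"
    using compact_cut rho_cut_nonempty assms convex_cut convex_connected by blast+
  then obtain a b where ab: "rho_cut m \<rho> = {a..b}"
    using connected_compact_interval_1[of "rho_cut m \<rho>"] by (auto simp: box_real)
  then show ?thesis using c unfolding lo_def hi_def by auto
qed

lemma lo_le_hi: "\<rho> \<in> {0..1} \<Longrightarrow> lo m \<rho> \<le> hi m \<rho>"
  using rho_cut_eq rho_cut_nonempty by force

lemma lo_hi_eqI:
  assumes "rho_cut m \<rho> = {a..b}" "\<rho> \<in> {0..1}"
  shows "lo m \<rho> = a" "hi m \<rho> = b"
  using assms rho_cut_eq[of \<rho> m] rho_cut_nonempty[of \<rho> m] by (auto simp: Icc_eq_Icc)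

lemma fuzzy_eqI:
  assumes "\<And>\<rho>. \<rho> \<in> {0..1} \<Longrightarrow> rho_cut m \<rho> = rho_cut l \<rho>"
  shows "m = l"
proof -
  have *: "membership m x \<le> membership l x" if "\<And>\<rho>. \<rho> \<in> {0..1} \<Longrightarrow> rho_cut m \<rho> = rho_cut l \<rho>" for m l x
  proof (cases "membership m x = 0")
    case False
    then have "x \<in> rho_cut m (membership m x)" by (simp add: rho_cut_pos)
    then have "x \<in> rho_cut l (membership m x)" using that[of "membership m x"] membership_range by auto
    then show ?thesis using False by (simp add: rho_cut_pos)
  qed (simp add: membership_range)
  have "membership m = membership l"
    using *[OF assms] *[OF assms[symmetric]] by (intro ext antisym) auto
  then show ?thesis by (simp add: membership_inject)
qed

lemma fuzzy_eqI_lo_hi: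
  assumes "\<And>\<rho>. \<rho> \<in> {0..1} \<Longrightarrow> lo m \<rho> = lo l \<rho>" "\<And>\<rho>. \<rho> \<in> {0..1} \<Longrightarrow> hi m \<rho> = hi l \<rho>"
  shows "m = l"
  using assms by (intro fuzzy_eqI) (simp add: rho_cut_eq)

lemma rho_cut_crisp: "\<rho> \<in> {0..1} \<Longrightarrow> rho_cut (crisp l) \<rho> = {l}"
  unfolding rho_cut_def crisp_def by (simp add: Fuzzy_inverse is_fuzzy_number_indicator fcut_indicator)

lemma lo_hi_crisp [simp]:
  assumes "\<rho> \<in> {0..1}" shows "lo (crisp l) \<rho> = l" "hi (crisp l) \<rho> = l"
  using rho_cut_crisp[OF assms] by (simp_all add: lo_def hi_def)

text \<open>
  \<open>endpoint f\<close> characterises the functions on the unit interval that arise as \<open>lo m\<close>;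
  those arising as \<open>hi m\<close> are their negatives.
\<close>

definition endpoint :: "(real \<Rightarrow> real) \<Rightarrow> bool" where
  "endpoint f \<longleftrightarrow>
     (\<forall>\<rho> \<sigma>. 0 \<le> \<rho> \<longrightarrow> \<rho> \<le> \<sigma> \<longrightarrow> \<sigma> \<le> 1 \<longrightarrow> f \<rho> \<le> f \<sigma>) \<and>
     (\<forall>\<rho>\<in>{0<..1}. \<forall>x<f \<rho>. \<exists>\<sigma>\<in>{0<..<\<rho>}. x < f \<sigma>) \<and>
     (\<forall>x>f 0. \<exists>\<sigma>\<in>{0<..1}. f \<sigma> < x)"

lemma endpoint_mono: "endpoint f \<Longrightarrow> 0 \<le> \<rho> \<Longrightarrow> \<rho> \<le> \<sigma> \<Longrightarrow> \<sigma> \<le> 1 \<Longrightarrow> f \<rho> \<le> f \<sigma>"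
  and endpoint_left: "endpoint f \<Longrightarrow> 0 < \<rho> \<Longrightarrow> \<rho> \<le> 1 \<Longrightarrow> x < f \<rho> \<Longrightarrow> \<exists>\<sigma>\<in>{0<..<\<rho>}. x < f \<sigma>"
  and endpoint_zero: "endpoint f \<Longrightarrow> f 0 < x \<Longrightarrow> \<exists>\<sigma>\<in>{0<..1}. f \<sigma> < x"
  unfolding endpoint_def by auto

lemma endpoint_lo_hi: "endpoint (lo m)" "endpoint (\<lambda>\<rho>. - hi m \<rho>)"
proof -
  have mono: "lo m \<rho> \<le> lo m \<sigma> \<and> hi m \<sigma> \<le> hi m \<rho>" if "0 \<le> \<rho>" "\<rho> \<le> \<sigma>" "\<sigma> \<le> 1" for \<rho> \<sigma>
    using rho_cut_antimono[of \<rho> \<sigma> m] that rho_cut_eq[of \<rho> m] rho_cut_eq[of \<sigma> m] lo_le_hi[of \<sigma> m] by auto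
  have mem: "x \<in> rho_cut m \<rho>" if "\<rho> \<in> {0<..1}" "\<And>\<sigma>. \<sigma> \<in> {0<..<\<rho>} \<Longrightarrow> x \<in> rho_cut m \<sigma>" for \<rho> x
  proof -
    have "\<rho> \<le> membership m x"
    proof (rule dense_le_bounded[of 0 \<rho>])
      show "0 < \<rho>" using that(1) by simp
      fix \<sigma> assume "0 < \<sigma>" "\<sigma> < \<rho>"
      then show "\<sigma> \<le> membership m x" using that(2)[of \<sigma>] by (simp add: rho_cut_pos)
    qed
    then show ?thesis using that(1) by (simp add: rho_cut_pos)
  qed
  have zero: "rho_cut m 0 \<subseteq> {a..b}" if "\<And>\<sigma>. \<sigma> \<in> {0<..1} \<Longrightarrow> rho_cut m \<sigma> \<subseteq> {a..b}" for a b
    unfolding rho_cut_zero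
  proof (intro closure_minimal subsetI)
    fix x assume "x \<in> {x. 0 < membership m x}"
    then have "x \<in> rho_cut m (membership m x)" "membership m x \<in> {0<..1}"
      using membership_range[of m x] by (auto simp: rho_cut_pos)
    then show "x \<in> {a..b}" using that by blast
  qed simp
  show "endpoint (lo m)" unfolding endpoint_def
  proof (intro conjI ballI allI impI)
    fix \<rho> x assume r: "\<rho> \<in> {0<..1}" and x: "x < lo m \<rho>"
    show "\<exists>\<sigma>\<in>{0<..<\<rho>}. x < lo m \<sigma>"
    proof (rule ccontr)
      assume n: "\<not> ?thesis"
      have "x \<in> rho_cut m \<rho>"
      proof (rule mem[OF r])
        fix \<sigma> assume s: "\<sigma> \<in> {0<..<\<rho>}"
        then have "lo m \<sigma> \<le> x" using n by force
        moreover have "x \<le> hi m \<sigma>" using mono[of \<sigma> \<rho>] lo_le_hi[of \<rho> m] r s x by auto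
        ultimately show "x \<in> rho_cut m \<sigma>" using rho_cut_eq[of \<sigma> m] r s by auto
      qed
      then show False using rho_cut_eq[of \<rho> m] r x by auto
    qed
  next
    fix x assume x: "lo m 0 < x"
    show "\<exists>\<sigma>\<in>{0<..1}. lo m \<sigma> < x"
    proof (rule ccontr)
      assume n: "\<not> ?thesis"
      have "rho_cut m 0 \<subseteq> {x..hi m 0}"
      proof (rule zero)
        fix \<sigma> :: real assume s: "\<sigma> \<in> {0<..1}"
        then have "x \<le> lo m \<sigma>" using n by force
        then show "rho_cut m \<sigma> \<subseteq> {x..hi m 0}" using rho_cut_eq[of \<sigma> m] mono[of 0 \<sigma>] s by auto
      qed
      then show False using rho_cut_eq[of 0 m] lo_le_hi[of 0 m] x by auto
    qed
  qed (use mono in auto)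
  show "endpoint (\<lambda>\<rho>. - hi m \<rho>)" unfolding endpoint_def
  proof (intro conjI ballI allI impI)
    fix \<rho> x assume r: "\<rho> \<in> {0<..1}" and x: "x < - hi m \<rho>"
    show "\<exists>\<sigma>\<in>{0<..<\<rho>}. x < - hi m \<sigma>"
    proof (rule ccontr)
      assume n: "\<not> ?thesis"
      have "- x \<in> rho_cut m \<rho>"
      proof (rule mem[OF r])
        fix \<sigma> assume s: "\<sigma> \<in> {0<..<\<rho>}"
        then have "- hi m \<sigma> \<le> x" using n by force
        moreover have "lo m \<sigma> \<le> - x" using mono[of \<sigma> \<rho>] lo_le_hi[of \<rho> m] r s x by auto
        ultimately show "- x \<in> rho_cut m \<sigma>" using rho_cut_eq[of \<sigma> m] r s by auto
      qed
      then show False using rho_cut_eq[of \<rho> m] r x by auto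
    qed
  next
    fix x assume x: "- hi m 0 < x"
    show "\<exists>\<sigma>\<in>{0<..1}. - hi m \<sigma> < x"
    proof (rule ccontr)
      assume n: "\<not> ?thesis"
      have "rho_cut m 0 \<subseteq> {lo m 0..- x}"
      proof (rule zero)
        fix \<sigma> :: real assume s: "\<sigma> \<in> {0<..1}"
        then have "x \<le> - hi m \<sigma>" using n by force
        then show "rho_cut m \<sigma> \<subseteq> {lo m 0..- x}" using rho_cut_eq[of \<sigma> m] mono[of 0 \<sigma>] s by auto
      qed
      then show False using rho_cut_eq[of 0 m] lo_le_hi[of 0 m] x by auto
    qed
  qed (use mono in auto)
qed

lemma endpoint_add:
  assumes f: "endpoint f" and g: "endpoint g"
  shows "endpoint (\<lambda>\<rho>. f \<rho> + g \<rho>)"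
  unfolding endpoint_def
proof (intro conjI ballI allI impI)
  fix \<rho> \<sigma> :: real assume "0 \<le> \<rho>" "\<rho> \<le> \<sigma>" "\<sigma> \<le> 1"
  then show "f \<rho> + g \<rho> \<le> f \<sigma> + g \<sigma>" by (intro add_mono endpoint_mono[OF f] endpoint_mono[OF g])
next
  fix \<rho> x assume r: "\<rho> \<in> {0<..1}" and x: "x < f \<rho> + g \<rho>"
  define e where "e = (f \<rho> + g \<rho> - x) / 2"
  have e: "e > 0" "x = (f \<rho> - e) + (g \<rho> - e)" using x by (auto simp: e_def field_simps)
  obtain s where s: "s \<in> {0<..<\<rho>}" "f \<rho> - e < f s"
    using endpoint_left[OF f, of \<rho> "f \<rho> - e"] r e by auto
  obtain t where t: "t \<in> {0<..<\<rho>}" "g \<rho> - e < g t"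
    using endpoint_left[OF g, of \<rho> "g \<rho> - e"] r e by auto
  have "f s \<le> f (max s t)" "g t \<le> g (max s t)"
    using s t r by (auto intro!: endpoint_mono[OF f] endpoint_mono[OF g])
  then show "\<exists>\<sigma>\<in>{0<..<\<rho>}. x < f \<sigma> + g \<sigma>"
    using s t e by (intro bexI[of _ "max s t"]) auto
next
  fix x assume x: "f 0 + g 0 < x"
  define e where "e = (x - f 0 - g 0) / 2"
  have e: "e > 0" "x = (f 0 + e) + (g 0 + e)" using x by (auto simp: e_def field_simps)
  obtain s where s: "s \<in> {0<..1}" "f s < f 0 + e"
    using endpoint_zero[OF f, of "f 0 + e"] e by auto
  obtain t where t: "t \<in> {0<..1}" "g t < g 0 + e"
    using endpoint_zero[OF g, of "g 0 + e"] e by auto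
  have "f (min s t) \<le> f s" "g (min s t) \<le> g t"
    using s t by (auto intro!: endpoint_mono[OF f] endpoint_mono[OF g])
  then show "\<exists>\<sigma>\<in>{0<..1}. f \<sigma> + g \<sigma> < x"
    using s t e by (intro bexI[of _ "min s t"]) auto
qed

lemma endpoint_scale:
  assumes f: "endpoint f" and c: "0 \<le> c"
  shows "endpoint (\<lambda>\<rho>. c * f \<rho>)"
proof (cases "c = 0")
  case True
  have "\<exists>\<sigma>. 0 < \<sigma> \<and> \<sigma> < \<rho>" if "0 < \<rho>" for \<rho> :: real using dense that by blast
  moreover have "\<exists>\<sigma>>0. \<sigma> \<le> (1::real)" by (rule exI[of _ 1]) simp
  ultimately show ?thesis using True by (auto simp: endpoint_def)
next
  case False
  then have c: "c > 0" using c by simp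
  show ?thesis unfolding endpoint_def
  proof (intro conjI ballI allI impI)
    fix \<rho> \<sigma> :: real assume "0 \<le> \<rho>" "\<rho> \<le> \<sigma>" "\<sigma> \<le> 1"
    then show "c * f \<rho> \<le> c * f \<sigma>" using endpoint_mono[OF f] c by simp
  next
    fix \<rho> x assume "\<rho> \<in> {0<..1}" "x < c * f \<rho>"
    then show "\<exists>\<sigma>\<in>{0<..<\<rho>}. x < c * f \<sigma>"
      using endpoint_left[OF f, of \<rho> "x / c"] c by (auto simp: field_simps)
  next
    fix x assume "c * f 0 < x"
    then show "\<exists>\<sigma>\<in>{0<..1}. c * f \<sigma> < x"
      using endpoint_zero[OF f, of "x / c"] c by (auto simp: field_simps)
  qed
qed

lemma fuzzy_from_cuts:
  assumes f: "endpoint f" and g: "endpoint (\<lambda>\<rho>. - g \<rho>)" and fg: "f 1 \<le> g 1"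
  shows "\<exists>m. \<forall>\<rho>\<in>{0..1}. rho_cut m \<rho> = {f \<rho>..g \<rho>}"
proof -
  have fm: "f \<rho> \<le> f \<sigma>" and gm: "g \<sigma> \<le> g \<rho>" if "0 \<le> \<rho>" "\<rho> \<le> \<sigma>" "\<sigma> \<le> 1" for \<rho> \<sigma>
    using endpoint_mono[OF f] endpoint_mono[OF g] that by auto
  define R where "R x = insert 0 {\<rho>. 0 < \<rho> \<and> \<rho> \<le> 1 \<and> f \<rho> \<le> x \<and> x \<le> g \<rho>}" for x
  define m where "m x = Sup (R x)" for x
  have bdd: "bdd_above (R x)" for x unfolding bdd_above_def R_def by (intro exI[of _ 1]) auto
  have ne: "R x \<noteq> {}" for x by (auto simp: R_def)
  have m0: "0 \<le> m x" for x unfolding m_def by (rule cSup_upper[OF _ bdd]) (simp add: R_def)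
  have m1: "m x \<le> 1" for x unfolding m_def by (rule cSup_least[OF ne]) (auto simp: R_def)
  have level: "\<rho> \<le> m x \<longleftrightarrow> x \<in> {f \<rho>..g \<rho>}" if r: "0 < \<rho>" "\<rho> \<le> 1" for \<rho> x
  proof
    assume "x \<in> {f \<rho>..g \<rho>}"
    then show "\<rho> \<le> m x" unfolding m_def using r by (intro cSup_upper[OF _ bdd]) (simp add: R_def)
  next
    assume le: "\<rho> \<le> m x"
    have key: False if s: "\<sigma> \<in> {0<..<\<rho>}" and out: "x < f \<sigma> \<or> g \<sigma> < x" for \<sigma>
    proof -
      have "m x \<le> \<sigma>" unfolding m_def
      proof (rule cSup_least[OF ne], rule ccontr)
        fix t assume t: "t \<in> R x" "\<not> t \<le> \<sigma>"
        then have "0 < t" "t \<le> 1" "f t \<le> x" "x \<le> g t" using s by (auto simp: R_def)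
        then show False using fm[of \<sigma> t] gm[of \<sigma> t] t s out by auto
      qed
      then show False using le s by auto
    qed
    have "f \<rho> \<le> x"
    proof (rule ccontr)
      assume "\<not> f \<rho> \<le> x"
      then show False using endpoint_left[OF f, of \<rho> x] r key by force
    qed
    moreover have "x \<le> g \<rho>"
    proof (rule ccontr)
      assume "\<not> x \<le> g \<rho>"
      then show False using endpoint_left[OF g, of \<rho> "- x"] r key by force
    qed
    ultimately show "x \<in> {f \<rho>..g \<rho>}" by simp
  qed
  have cutpos: "fcut m \<rho> = {f \<rho>..g \<rho>}" if "0 < \<rho>" "\<rho> \<le> 1" for \<rho>
    using that by (intro set_eqI) (simp add: fcut_def level del: atLeastAtMost_iff)
  have pos: "0 < m x \<longleftrightarrow> (\<exists>\<rho>\<in>{0<..1}. x \<in> {f \<rho>..g \<rho>})" for x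
  proof
    assume "0 < m x"
    then show "\<exists>\<rho>\<in>{0<..1}. x \<in> {f \<rho>..g \<rho>}" using level[of "m x" x] m1[of x] by auto
  next
    assume "\<exists>\<rho>\<in>{0<..1}. x \<in> {f \<rho>..g \<rho>}"
    then obtain \<rho> where "\<rho> \<in> {0<..1}" "x \<in> {f \<rho>..g \<rho>}" by blast
    then show "0 < m x" using level[of \<rho> x] by auto
  qed
  have cut0: "fcut m 0 = {f 0..g 0}"
  proof -
    have "closure {x. 0 < m x} = {f 0..g 0}"
    proof
      show "closure {x. 0 < m x} \<subseteq> {f 0..g 0}"
      proof (rule closure_minimal)
        show "{x. 0 < m x} \<subseteq> {f 0..g 0}"
        proof
          fix x assume "x \<in> {x. 0 < m x}"
          then obtain \<rho> where "\<rho> \<in> {0<..1}" "x \<in> {f \<rho>..g \<rho>}" using pos by blast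
          then show "x \<in> {f 0..g 0}" using fm[of 0 \<rho>] gm[of 0 \<rho>] by auto
        qed
      qed simp
      have f01: "f 0 \<le> f 1" "g 1 \<le> g 0" using fm gm by auto
      show "{f 0..g 0} \<subseteq> closure {x. 0 < m x}"
      proof (cases "f 0 = g 0")
        case True
        then have "{f 0..g 0} \<subseteq> {x. 0 < m x}"
          using f01 fg by (auto simp: pos intro!: bexI[of _ 1])
        then show ?thesis using closure_subset by blast
      next
        case False
        then have lt: "f 0 < g 0" using f01 fg by simp
        have "{f 0<..<g 0} \<subseteq> {x. 0 < m x}"
        proof
          fix x assume x: "x \<in> {f 0<..<g 0}"
          obtain s where s: "s \<in> {0<..1}" "f s < x" using endpoint_zero[OF f, of x] x by auto
          obtain t where t: "t \<in> {0<..1}" "x < g t" using endpoint_zero[OF g, of "- x"] x by auto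
          have "f (min s t) \<le> f s" "g t \<le> g (min s t)" using s t by (auto intro!: fm gm)
          then have "\<exists>\<rho>\<in>{0<..1}. x \<in> {f \<rho>..g \<rho>}"
            using s t by (intro bexI[of _ "min s t"]) auto
          then show "x \<in> {x. 0 < m x}" by (simp add: pos)
        qed
        then have "closure {f 0<..<g 0} \<subseteq> closure {x. 0 < m x}" by (rule closure_mono)
        then show ?thesis using closure_greaterThanLessThan[OF lt] by simp
      qed
    qed
    then show ?thesis by (simp add: fcut_def)
  qed
  have "is_fuzzy_number m" unfolding is_fuzzy_number_def
  proof (intro conjI allI ballI)
    show "range m \<subseteq> {0..1}" using m0 m1 by auto
    have "1 \<le> m (f 1)" using level[of 1 "f 1"] fg by simp
    then show "\<exists>x. m x = 1" using m1 antisym by blast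
    show "compact (fcut m 0)" by (simp add: cut0)
    show "upper_semicontinuous m" unfolding upper_semicontinuous_def
    proof (intro allI impI)
      fix x y assume y: "m x < y"
      show "\<forall>\<^sub>F z in nhds x. m z < y"
      proof (cases "y \<le> 1")
        case True
        have y0: "0 < y" using y m0[of x] by simp
        have nlevel: "m z < y \<longleftrightarrow> z \<in> - {f y..g y}" for z using level[OF y0 True, of z] by auto
        have "open (- {f y..g y})" by (simp add: open_Compl)
        moreover have "x \<in> - {f y..g y}" using y nlevel by blast
        ultimately show ?thesis unfolding nlevel by (rule eventually_nhds_in_open)
      next
        case False
        then show ?thesis by (intro always_eventually allI) (use m1 in \<open>meson le_less_trans not_le\<close>)
      qed
    qed
    fix x1 x2 \<theta> :: real assume t: "\<theta> \<in> {0..1}"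
    let ?r = "min (m x1) (m x2)"
    show "?r \<le> m (\<theta> * x1 + (1 - \<theta>) * x2)"
    proof (cases "?r = 0")
      case False
      then have r: "0 < ?r" "?r \<le> 1" using m0[of x1] m0[of x2] m1[of x1] by (auto simp: min_def)
      have "x1 \<in> {f ?r..g ?r}" "x2 \<in> {f ?r..g ?r}"
        using level[OF r, of x1] level[OF r, of x2] by auto
      moreover have "convex {f ?r..g ?r}" by simp
      ultimately have "\<theta> *\<^sub>R x1 + (1 - \<theta>) *\<^sub>R x2 \<in> {f ?r..g ?r}"
        using t by (intro convexD) auto
      then show ?thesis using level[OF r, of "\<theta> * x1 + (1 - \<theta>) * x2"] by simp
    qed (use m0 in simp)
  qed
  then have "rho_cut (Fuzzy m) = fcut m" unfolding rho_cut_def by (simp add: Fuzzy_inverse)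
  moreover have "fcut m \<rho> = {f \<rho>..g \<rho>}" if "\<rho> \<in> {0..1}" for \<rho>
    using cutpos[of \<rho>] cut0 that by (cases "\<rho> = 0") auto
  ultimately show ?thesis by metis
qed

instantiation fuzzy :: comm_monoid_add
begin

definition zero_fuzzy :: fuzzy where
  "0 = crisp 0"

definition plus_fuzzy :: "fuzzy \<Rightarrow> fuzzy \<Rightarrow> fuzzy" where
  "m + l = (THE s. \<forall>\<rho>\<in>{0..1}. rho_cut s \<rho> = {lo m \<rho> + lo l \<rho>..hi m \<rho> + hi l \<rho>})"

lemma rho_cut_plus:
  assumes "\<rho> \<in> {0..1}"
  shows "rho_cut (m + l) \<rho> = {lo m \<rho> + lo l \<rho>..hi m \<rho> + hi l \<rho>}"
proof -
  let ?P = "\<lambda>s. \<forall>\<rho>\<in>{0..1}. rho_cut s \<rho> = {lo m \<rho> + lo l \<rho>..hi m \<rho> + hi l \<rho>}"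
  have "\<exists>s. ?P s"
    using endpoint_add[OF endpoint_lo_hi(2)[of m] endpoint_lo_hi(2)[of l]] lo_le_hi[of 1]
    by (intro fuzzy_from_cuts endpoint_add endpoint_lo_hi) (auto simp: add_mono)
  moreover have "s = t" if "?P s" "?P t" for s t
    using that by (intro fuzzy_eqI) simp
  ultimately have "\<exists>!s. ?P s" by blast
  then have "?P (m + l)" unfolding plus_fuzzy_def by (rule theI')
  then show ?thesis using assms by blast
qed

lemma lo_plus [simp]: "\<rho> \<in> {0..1} \<Longrightarrow> lo (m + l) \<rho> = lo m \<rho> + lo l \<rho>"
  and hi_plus [simp]: "\<rho> \<in> {0..1} \<Longrightarrow> hi (m + l) \<rho> = hi m \<rho> + hi l \<rho>"
  using lo_hi_eqI[OF rho_cut_plus] by blast+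

instance
  by standard (auto intro!: fuzzy_eqI_lo_hi simp: zero_fuzzy_def simp del: atLeastAtMost_iff)

end

instantiation fuzzy :: scaleR
begin

definition scaleR_fuzzy :: "real \<Rightarrow> fuzzy \<Rightarrow> fuzzy" where
  "c *\<^sub>R m = (THE s. \<forall>\<rho>\<in>{0..1}.
     rho_cut s \<rho> = {min (c * lo m \<rho>) (c * hi m \<rho>)..max (c * lo m \<rho>) (c * hi m \<rho>)})"

instance ..

end

lemma rho_cut_scaleR:
  fixes m :: fuzzy
  assumes "\<rho> \<in> {0..1}"
  shows "rho_cut (c *\<^sub>R m) \<rho> = {min (c * lo m \<rho>) (c * hi m \<rho>)..max (c * lo m \<rho>) (c * hi m \<rho>)}"
proof -
  let ?P = "\<lambda>s. \<forall>\<rho>\<in>{0..1}.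
    rho_cut s \<rho> = {min (c * lo m \<rho>) (c * hi m \<rho>)..max (c * lo m \<rho>) (c * hi m \<rho>)}"
  have "\<exists>s. ?P s"
  proof (cases "0 \<le> c")
    case True
    have "\<exists>s. \<forall>\<rho>\<in>{0..1}. rho_cut s \<rho> = {c * lo m \<rho>..c * hi m \<rho>}"
      using endpoint_scale[OF endpoint_lo_hi(2)[of m] True] lo_le_hi[of 1] True
      by (intro fuzzy_from_cuts endpoint_scale endpoint_lo_hi) (auto simp: mult_left_mono)
    moreover have "c * lo m \<rho> \<le> c * hi m \<rho>" if "\<rho> \<in> {0..1}" for \<rho>
      using lo_le_hi[OF that] True by (rule mult_left_mono)
    ultimately show ?thesis by (simp add: min_def max_def)
  next
    case False
    have "\<exists>s. \<forall>\<rho>\<in>{0..1}. rho_cut s \<rho> = {c * hi m \<rho>..c * lo m \<rho>}"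
      using endpoint_scale[OF endpoint_lo_hi(2)[of m], of "- c"]
        endpoint_scale[OF endpoint_lo_hi(1)[of m], of "- c"] lo_le_hi[of 1 m] False
      by (intro fuzzy_from_cuts) (auto simp: mult_left_mono_neg)
    moreover have "c * hi m \<rho> \<le> c * lo m \<rho>" if "\<rho> \<in> {0..1}" for \<rho>
      using lo_le_hi[OF that] False by (intro mult_left_mono_neg) auto
    ultimately show ?thesis by (simp add: min_absorb2 max_absorb1)
  qed
  moreover have "s = t" if "?P s" "?P t" for s t
    using that by (intro fuzzy_eqI) simp
  ultimately have "\<exists>!s. ?P s" by blast
  then have "?P (c *\<^sub>R m)" unfolding scaleR_fuzzy_def by (rule theI')
  then show ?thesis using assms by blast
qed

lemma lo_scaleR: "\<rho> \<in> {0..1} \<Longrightarrow> lo (c *\<^sub>R m) \<rho> = min (c * lo m \<rho>) (c * hi m \<rho>)"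
  and hi_scaleR: "\<rho> \<in> {0..1} \<Longrightarrow> hi (c *\<^sub>R m) \<rho> = max (c * lo m \<rho>) (c * hi m \<rho>)"
  using lo_hi_eqI[OF rho_cut_scaleR] by blast+

instantiation fuzzy :: metric_space
begin

definition dist_fuzzy :: "fuzzy \<Rightarrow> fuzzy \<Rightarrow> real" where
  "dist m l = (SUP \<rho>\<in>{0..1}. max \<bar>lo m \<rho> - lo l \<rho>\<bar> \<bar>hi m \<rho> - hi l \<rho>\<bar>)"

definition uniformity_fuzzy :: "(fuzzy \<times> fuzzy) filter" where
  "uniformity_fuzzy = (INF e\<in>{0<..}. principal {(x, y). dist x y < e})"

definition open_fuzzy :: "fuzzy set \<Rightarrow> bool" where
  "open_fuzzy U \<longleftrightarrow> (\<forall>x\<in>U. \<forall>\<^sub>F (x', y) in uniformity. x' = x \<longrightarrow> y \<in> U)"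

lemma bdd_above_fuzzy_dist:
  "bdd_above ((\<lambda>\<rho>. max \<bar>lo m \<rho> - lo l \<rho>\<bar> \<bar>hi m \<rho> - hi l \<rho>\<bar>) ` {0..1})"
proof -
  let ?B = "\<lambda>m. \<bar>lo m 0\<bar> + \<bar>hi m 0\<bar>"
  have B: "\<bar>lo m \<rho>\<bar> \<le> ?B m \<and> \<bar>hi m \<rho>\<bar> \<le> ?B m" if "\<rho> \<in> {0..1}" for m \<rho>
    using endpoint_mono[OF endpoint_lo_hi(1)[of m], of 0 \<rho>]
      endpoint_mono[OF endpoint_lo_hi(2)[of m], of 0 \<rho>] lo_le_hi[OF that, of m] that by auto
  have "max \<bar>lo m \<rho> - lo l \<rho>\<bar> \<bar>hi m \<rho> - hi l \<rho>\<bar> \<le> ?B m + ?B l" if "\<rho> \<in> {0..1}" for \<rho>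
    using B[OF that, of m] B[OF that, of l] by linarith
  then show ?thesis unfolding bdd_above_def by blast
qed

lemma fuzzy_dist_ge:
  assumes "\<rho> \<in> {0..1}"
  shows "\<bar>lo m \<rho> - lo l \<rho>\<bar> \<le> dist m l" "\<bar>hi m \<rho> - hi l \<rho>\<bar> \<le> dist m l"
  using cSUP_upper[OF assms bdd_above_fuzzy_dist, of m l] unfolding dist_fuzzy_def by auto

lemma fuzzy_dist_le:
  assumes "\<And>\<rho>. \<rho> \<in> {0..1} \<Longrightarrow> \<bar>lo m \<rho> - lo l \<rho>\<bar> \<le> b" "\<And>\<rho>. \<rho> \<in> {0..1} \<Longrightarrow> \<bar>hi m \<rho> - hi l \<rho>\<bar> \<le> b"
  shows "dist m l \<le> b"
  unfolding dist_fuzzy_def using assms by (intro cSUP_least) auto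

instance
proof
  fix m l k :: fuzzy
  show "dist m l = 0 \<longleftrightarrow> m = l"
  proof
    assume "dist m l = 0"
    then show "m = l" using fuzzy_dist_ge[of _ m l] by (intro fuzzy_eqI_lo_hi) force+
  qed (simp add: dist_fuzzy_def)
  have "\<bar>lo m \<rho> - lo l \<rho>\<bar> \<le> dist m k + dist l k" "\<bar>hi m \<rho> - hi l \<rho>\<bar> \<le> dist m k + dist l k"
    if "\<rho> \<in> {0..1}" for \<rho>
    using fuzzy_dist_ge[OF that, of m k] fuzzy_dist_ge[OF that, of l k] by linarith+
  then show "dist m l \<le> dist m k + dist l k" by (rule fuzzy_dist_le)
qed (rule uniformity_fuzzy_def open_fuzzy_def)+

end

definition is_gH_diff :: "fuzzy \<Rightarrow> fuzzy \<Rightarrow> fuzzy \<Rightarrow> bool" where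
  "is_gH_diff m l \<gamma> \<longleftrightarrow> m = l + \<gamma> \<or> l = m + (-1) *\<^sub>R \<gamma>"

definition gH_diff_exists :: "fuzzy \<Rightarrow> fuzzy \<Rightarrow> bool" where
  "gH_diff_exists m l \<longleftrightarrow> (\<exists>\<gamma>. is_gH_diff m l \<gamma>)"

text \<open>The value is meaningful only under \<open>gH_diff_exists\<close>; it is then unique by \<open>lo_hi_gH\<close>.\<close>

definition gH_diff :: "fuzzy \<Rightarrow> fuzzy \<Rightarrow> fuzzy"  (infixl \<open>\<ominus>\<^sub>g\<^sub>H\<close> 65) where
  "m \<ominus>\<^sub>g\<^sub>H l = (THE \<gamma>. is_gH_diff m l \<gamma>)"

lemma lo_hi_gH:
  assumes g: "is_gH_diff m l \<gamma>" and r: "\<rho> \<in> {0..1}"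
  shows "lo \<gamma> \<rho> = min (lo m \<rho> - lo l \<rho>) (hi m \<rho> - hi l \<rho>)"
    and "hi \<gamma> \<rho> = max (lo m \<rho> - lo l \<rho>) (hi m \<rho> - hi l \<rho>)"
proof -
  note le = lo_le_hi[OF r, of \<gamma>]
  have "lo \<gamma> \<rho> = min (lo m \<rho> - lo l \<rho>) (hi m \<rho> - hi l \<rho>) \<and>
    hi \<gamma> \<rho> = max (lo m \<rho> - lo l \<rho>) (hi m \<rho> - hi l \<rho>)"
    using g unfolding is_gH_diff_def
  proof
    assume "m = l + \<gamma>"
    then show ?thesis using r le by (simp del: atLeastAtMost_iff)
  next
    assume l: "l = m + (-1) *\<^sub>R \<gamma>"
    have "lo l \<rho> = lo m \<rho> - hi \<gamma> \<rho>" "hi l \<rho> = hi m \<rho> - lo \<gamma> \<rho>"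
      unfolding l using r le by (simp_all add: lo_scaleR hi_scaleR del: atLeastAtMost_iff)
    then show ?thesis using le by simp
  qed
  then show "lo \<gamma> \<rho> = min (lo m \<rho> - lo l \<rho>) (hi m \<rho> - hi l \<rho>)"
    "hi \<gamma> \<rho> = max (lo m \<rho> - lo l \<rho>) (hi m \<rho> - hi l \<rho>)" by auto
qed

lemma gH_diff_eqI: "is_gH_diff m l \<gamma> \<Longrightarrow> m \<ominus>\<^sub>g\<^sub>H l = \<gamma>"
  unfolding gH_diff_def
  by (rule the_equality) (auto intro!: fuzzy_eqI_lo_hi simp: lo_hi_gH simp del: atLeastAtMost_iff)

definition fuzzy_less :: "fuzzy \<Rightarrow> fuzzy \<Rightarrow> bool"  (infix \<open>\<prec>\<^sub>F\<close> 50) where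
  "m \<prec>\<^sub>F l \<longleftrightarrow> (\<forall>\<rho>\<in>{0..1}. lo m \<rho> < lo l \<rho> \<and> hi m \<rho> < hi l \<rho>)"

text \<open>
  A fuzzy function on \<open>T\<close> is a total function of which only the values on \<open>T\<close> are used:
  the limits below run over the admissible increments, and the filter \<open>at 0 within S\<close>
  excludes the increment 0.
\<close>

definition has_gH_partial ::
    "(real^'n \<Rightarrow> fuzzy) \<Rightarrow> (real^'n) set \<Rightarrow> real^'n \<Rightarrow> 'n \<Rightarrow> fuzzy \<Rightarrow> bool" where
  "has_gH_partial H T x i D \<longleftrightarrow>
     (let S = {d. x + d *\<^sub>R axis i 1 \<in> T} in
        0 islimpt S \<and>
        (\<forall>\<^sub>F d in at 0 within S. gH_diff_exists (H (x + d *\<^sub>R axis i 1)) (H x)) \<and>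
        ((\<lambda>d. (1 / d) *\<^sub>R (H (x + d *\<^sub>R axis i 1) \<ominus>\<^sub>g\<^sub>H H x)) \<longlongrightarrow> D) (at 0 within S))"

lemma has_gH_partial_unique:
  assumes "has_gH_partial H T x i D" "has_gH_partial H T x i E"
  shows "D = E"
  using assms unfolding has_gH_partial_def Let_def
  by (elim conjE) (rule tendsto_unique[rotated], assumption+, simp add: trivial_limit_within)

definition gH_gradient :: "(real^'n \<Rightarrow> fuzzy) \<Rightarrow> (real^'n) set \<Rightarrow> real^'n \<Rightarrow> fuzzy^'n" where
  "gH_gradient H T x = (\<chi> i. THE D. has_gH_partial H T x i D)"

definition dot_fuzzy :: "real^'n \<Rightarrow> fuzzy^'n \<Rightarrow> fuzzy"  (infixl \<open>\<bullet>\<^sub>F\<close> 70) where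
  "\<tau> \<bullet>\<^sub>F G = (\<Sum>i\<in>UNIV. (\<tau> $ i) *\<^sub>R (G $ i))"

definition gH_differentiable ::
    "(real^'n \<Rightarrow> fuzzy) \<Rightarrow> (real^'n) set \<Rightarrow> real^'n \<Rightarrow> bool" where
  "gH_differentiable H T x \<longleftrightarrow>
     (\<forall>i. \<exists>D. has_gH_partial H T x i D) \<and>
     (\<forall>\<tau>. let K = {\<kappa>. 0 < \<kappa> \<and> x + \<kappa> *\<^sub>R \<tau> \<in> T} in
        0 islimpt K \<longrightarrow>
        (\<forall>\<^sub>F \<kappa> in at 0 within K. gH_diff_exists (H (x + \<kappa> *\<^sub>R \<tau>)) (H x)) \<and>
        ((\<lambda>\<kappa>. (1 / \<kappa>) *\<^sub>R (H (x + \<kappa> *\<^sub>R \<tau>) \<ominus>\<^sub>g\<^sub>H H x)) \<longlongrightarrow> \<tau> \<bullet>\<^sub>F gH_gradient H T x)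
          (at 0 within K))"

definition local_optimal ::
    "(real^'n \<Rightarrow> fuzzy) \<Rightarrow> (real^'n) set \<Rightarrow> real^'n \<Rightarrow> bool" where
  "local_optimal H T x \<longleftrightarrow>
     x \<in> T \<and> (\<exists>\<delta>>0. \<not> (\<exists>y\<in>T. 0 < norm (y - x) \<and> norm (y - x) < \<delta> \<and> H y \<prec>\<^sub>F H x))"

definition descent_directions ::
    "(real^'n \<Rightarrow> fuzzy) \<Rightarrow> (real^'n) set \<Rightarrow> real^'n \<Rightarrow> (real^'n) set" where
  "descent_directions H T x = {\<tau>. \<tau> \<bullet>\<^sub>F gH_gradient H T x \<prec>\<^sub>F crisp 0}"

definition feasible_directions :: "(real^'n) set \<Rightarrow> real^'n \<Rightarrow> (real^'n) set" where
  "feasible_directions T x = {\<tau>. \<exists>\<delta>>0. \<forall>\<kappa>\<in>{0<..<\<delta>}. x + \<kappa> *\<^sub>R \<tau> \<in> T}"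

end

theory Submission
  imports Defs
begin

text \<open>
  If \<open>\<tau>\<close> is both a descent direction and a feasible one, the difference quotients of \<open>H\<close> along
  \<open>\<tau>\<close> converge to a fuzzy number \<open>D \<prec>\<^sub>F crisp 0\<close>. The relation \<open>\<prec>\<^sub>F\<close> asks for a
  strict inequality at every level, and infinitely many strict inequalities need not survive
  a small perturbation. Below a crisp number they do: cuts shrink as the level grows, so the single
  number \<open>hi D 0\<close> bounds all endpoints of \<open>D\<close> (lemma \<open>fuzzy_less_crisp_iff\<close>), and every fuzzy
  number closer to \<open>D\<close> than the gap below \<open>0\<close> is still negative
  (lemma \<open>eventually_fuzzy_less_crisp\<close>).
  Hence the difference quotients are negative for small steps. Both endpoint differences of two
  fuzzy numbers lie between the endpoints of their gH-difference, so negativity of the quotient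
  gives \<open>H (x + \<kappa> *\<^sub>R \<tau>) \<prec>\<^sub>F H x\<close> (lemma \<open>fuzzy_less_of_quotient\<close>). Such points exist
  arbitrarily close to \<open>x\<close> and contradict local optimality.
\<close>

lemma hi_antimono:
  assumes "0 \<le> \<rho>" "\<rho> \<le> \<sigma>" "\<sigma> \<le> 1"
  shows "hi m \<sigma> \<le> hi m \<rho>"
  using endpoint_mono[OF endpoint_lo_hi(2) assms] by simp

text \<open>
  The reduction to one level is what makes this order relation an open condition: \<open>hi m 0\<close> is the
  largest of all endpoints of cuts of \<open>m\<close>.
\<close>

lemma fuzzy_less_crisp_iff: "m \<prec>\<^sub>F crisp c \<longleftrightarrow> hi m 0 < c"
proof
  assume "m \<prec>\<^sub>F crisp c"
  then have "hi m 0 < hi (crisp c) 0" by (simp add: fuzzy_less_def)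
  then show "hi m 0 < c" by simp
next
  assume c: "hi m 0 < c"
  have "lo m \<rho> < c \<and> hi m \<rho> < c" if "\<rho> \<in> {0..1}" for \<rho>
    using hi_antimono[of 0 \<rho> m] lo_le_hi[OF that, of m] that c by auto
  then show "m \<prec>\<^sub>F crisp c" by (simp add: fuzzy_less_def)
qed

lemma eventually_fuzzy_less_crisp:
  assumes f: "(f \<longlongrightarrow> D) F" and D: "D \<prec>\<^sub>F crisp c"
  shows "\<forall>\<^sub>F t in F. f t \<prec>\<^sub>F crisp c"
proof -
  have "0 < c - hi D 0" using D by (simp add: fuzzy_less_crisp_iff)
  with f have "\<forall>\<^sub>F t in F. dist (f t) D < c - hi D 0" by (rule tendstoD)
  then show ?thesis
  proof eventually_elim
    case (elim t)
    then show ?case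
      using fuzzy_dist_ge(2)[of 0 "f t" D] by (simp add: fuzzy_less_crisp_iff)
  qed
qed

text \<open>
  Since \<open>k > 0\<close>, scaling does not swap endpoints, and the upper endpoint of the gH-difference is the
  larger of the two endpoint differences; when it is negative, both of them are.
\<close>

lemma fuzzy_less_of_quotient:
  assumes ex: "gH_diff_exists m l" and k: "0 < k"
    and less: "(1 / k) *\<^sub>R (m \<ominus>\<^sub>g\<^sub>H l) \<prec>\<^sub>F crisp 0"
  shows "m \<prec>\<^sub>F l"
  unfolding fuzzy_less_def
proof
  fix \<rho> :: real assume r: "\<rho> \<in> {0..1}"
  from ex obtain \<gamma> where g: "is_gH_diff m l \<gamma>" by (auto simp: gH_diff_exists_def)
  have "hi ((1 / k) *\<^sub>R \<gamma>) \<rho> < 0"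
    using less r by (simp add: fuzzy_less_def gH_diff_eqI[OF g])
  then have "(1 / k) * hi \<gamma> \<rho> < 0"
    using r by (simp add: hi_scaleR)
  then have "hi \<gamma> \<rho> < 0" using k by (simp add: divide_less_0_iff)
  then show "lo m \<rho> < lo l \<rho> \<and> hi m \<rho> < hi l \<rho>"
    by (simp add: lo_hi_gH(2)[OF g r])
qed

theorem theorem3p6:
  fixes T :: "(real^'n) set" and H :: "real^'n \<Rightarrow> fuzzy" and x :: "real^'n"
  assumes "T \<noteq> {}"
    and "x \<in> T"
    and "gH_differentiable H T x"
    and "local_optimal H T x"
  shows "descent_directions H T x \<inter> feasible_directions T x = {}"
proof (rule ccontr)
  assume "\<not> ?thesis"
  then obtain \<tau> where neg: "\<tau> \<bullet>\<^sub>F gH_gradient H T x \<prec>\<^sub>F crisp 0"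
    and "\<tau> \<in> feasible_directions T x"
    by (auto simp: descent_directions_def)
  then obtain \<delta> where d: "\<delta> > 0" and feas: "\<And>\<kappa>. \<kappa> \<in> {0<..<\<delta>} \<Longrightarrow> x + \<kappa> *\<^sub>R \<tau> \<in> T"
    by (auto simp: feasible_directions_def)
  obtain \<epsilon> where e: "\<epsilon> > 0"
    and opt: "\<And>y. y \<in> T \<Longrightarrow> 0 < norm (y - x) \<Longrightarrow> norm (y - x) < \<epsilon> \<Longrightarrow> \<not> H y \<prec>\<^sub>F H x"
    using assms(4) unfolding local_optimal_def by blast
  define K where "K = {\<kappa>. 0 < \<kappa> \<and> x + \<kappa> *\<^sub>R \<tau> \<in> T}"
  let ?F = "at (0::real) within K"

  have "0 islimpt {0<..<\<delta>}" using d by (simp add: islimpt_greaterThanLessThan1)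
  then have lim: "0 islimpt K"
    by (rule islimpt_subset) (use feas in \<open>auto simp: K_def\<close>)
  have ex: "\<forall>\<^sub>F \<kappa> in ?F. gH_diff_exists (H (x + \<kappa> *\<^sub>R \<tau>)) (H x)"
    and conv: "((\<lambda>\<kappa>. (1 / \<kappa>) *\<^sub>R (H (x + \<kappa> *\<^sub>R \<tau>) \<ominus>\<^sub>g\<^sub>H H x)) \<longlongrightarrow> \<tau> \<bullet>\<^sub>F gH_gradient H T x) ?F"
    using assms(3) lim unfolding gH_differentiable_def K_def Let_def by blast+

  have "((\<lambda>\<kappa>. norm (\<kappa> *\<^sub>R \<tau>)) \<longlongrightarrow> norm (0 *\<^sub>R \<tau>)) ?F"
    by (intro tendsto_intros)
  then have near: "\<forall>\<^sub>F \<kappa> in ?F. norm (\<kappa> *\<^sub>R \<tau>) < \<epsilon>"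
    by (rule order_tendstoD(2)) (use e in simp)
  have inK: "\<forall>\<^sub>F \<kappa> in ?F. \<kappa> \<in> K"
    by (simp add: eventually_at_filter)
  have "\<forall>\<^sub>F \<kappa> in ?F. False"
    using ex eventually_fuzzy_less_crisp[OF conv neg] near inK
  proof eventually_elim
    case (elim \<kappa>)
    then have T: "x + \<kappa> *\<^sub>R \<tau> \<in> T" and less: "H (x + \<kappa> *\<^sub>R \<tau>) \<prec>\<^sub>F H x"
      by (auto simp: K_def intro: fuzzy_less_of_quotient)
    \<comment> \<open>This also disposes of \<open>\<tau> = 0\<close>, for which the points \<open>x + \<kappa> *\<^sub>R \<tau>\<close> never leave \<open>x\<close>.\<close>
    have "x + \<kappa> *\<^sub>R \<tau> \<noteq> x"
    proof
      assume "x + \<kappa> *\<^sub>R \<tau> = x"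
      with less have "H x \<prec>\<^sub>F H x" by simp
      then show False by (auto simp: fuzzy_less_def)
    qed
    then have "0 < norm (x + \<kappa> *\<^sub>R \<tau> - x)" "norm (x + \<kappa> *\<^sub>R \<tau> - x) < \<epsilon>"
      using elim by auto
    with opt[OF T] less show False by blast
  qed
  with lim show False by (simp add: trivial_limit_within)
qed

end
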